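(* Let $T\subset\mathbb{R}^n$ be a billiard table and let $p=(p_1,\dots,p_m)$ be a length-minimizing closed billiard trajectory on $T$. Let $U\subseteq\mathbb{R}^n$ be the convex cone spanned by the outer unit normal vectors of the $T$-supporting hyperplanes $H_1,\dots,H_m$ through $p_1,\dots,p_m$ associated to the billiard reflection rule, and let $V\subseteq\mathbb{R}^n$ be the affine subspace such that $T\cap V$ is the inclusion minimal affine section of $T$ that contains $p$. Let $V_0$ be the linear subspace parallel to $V$ with $\dim V_0=\dim V$. Then $$U=V_0,\qquad \dim U=\dim V=m-1,$$ and $$\dim\left(N_T(p_j)\cap V_0\right)=1\quad\text{for all } j\in\{1,\dots,m\}.$$
   Context: A billiard table is a convex body $T\subset\mathbb{R}^n$, i.e. a compact convex set with non-empty interior; $\|\cdot\|$ is the Euclidean norm and $\langle\cdot,\cdot\rangle$ the Euclidean inner product. A closed polygonal curve is given by its cyclically ordered vertices $p_1,\dots,p_m$ with $m\ge 2$, indices taken modulo $m$, where it is always assumed that $p_j\ne p_{j+1}$ and that $p_j$ does not lie on the line segment connecting $p_{j-1}$ and $p_{j+1}$, for all $j$. A $T$-supporting hyperplane through $q\in\partial T$ is a hyperplane $H\ni q$ such that $T$ lies in one of the two closed half-spaces bounded by $H$; its outer unit normal is the unit normal $\nu$ with $\langle \nu,y-q\rangle\le 0$ for all $y\in T$. A closed polygonal curve with vertices $p_1,\dots,p_m\in\partial T$ is a closed billiard trajectory on $T$ if for every $j\in\{1,\dots,m\}$ there is a $T$-supporting hyperplane $H_j$ through $p_j$ such that $p_j$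 minimizes $\|\bar p_j-p_{j-1}\|+\|p_{j+1}-\bar p_j\|$ over all $\bar p_j\in H_j$; these $H_j$ are the hyperplanes associated to the billiard reflection rule. The trajectory is denoted $(p_1,\dots,p_m)$. Its length is $\ell((p_1,\dots,p_m))=\sum_{j=1}^m\|p_{j+1}-p_j\|$. It is length-minimizing if its length is minimal among all closed billiard trajectories on $T$ (with any number of vertices). An affine section of $T$ is a set $T\cap V$ with $V\subseteq\mathbb{R}^n$ an affine subspace; the affine subspace $V$ belonging to the inclusion minimal affine section containing $p$ is the affine hull of $p_1,\dots,p_m$. The outer normal cone is $N_T(q)=\{\nu\in\mathbb{R}^n:\langle \nu,y-q\rangle\le 0\text{ for all }y\in T\}$ for $q\in\partial T$. The dimension of a convex cone is the dimension of its linear span. *)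

theory Defs
  imports "HOL-Analysis.Analysis"
begin

definition billiard_table :: "'a::euclidean_space set \<Rightarrow> bool" where
  "billiard_table T \<longleftrightarrow> compact T \<and> convex T \<and> interior T \<noteq> {}"

text \<open>
  A closed polygonal curve with \<open>m\<close> vertices is a function \<open>p\<close> of which only the values
  \<open>p 0, \<dots>, p (m - 1)\<close> matter; indices are read modulo \<open>m\<close>.
\<close>

definition next_idx :: "nat \<Rightarrow> nat \<Rightarrow> nat" where
  "next_idx m j = (j + 1) mod m"

definition prev_idx :: "nat \<Rightarrow> nat \<Rightarrow> nat" where
  "prev_idx m j = (j + m - 1) mod m"

definition closed_polygonal_curve :: "nat \<Rightarrow> (nat \<Rightarrow> 'a::euclidean_space) \<Rightarrow> bool" where
  "closed_polygonal_curve m p \<longleftrightarrow> m \<ge> 2 \<and>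
     (\<forall>j<m. p j \<noteq> p (next_idx m j) \<and>
            p j \<notin> closed_segment (p (prev_idx m j)) (p (next_idx m j)))"

definition curve_length :: "nat \<Rightarrow> (nat \<Rightarrow> 'a::euclidean_space) \<Rightarrow> real" where
  "curve_length m p = (\<Sum>j<m. norm (p (next_idx m j) - p j))"

text \<open>
  Replacing \<open>(a, b)\<close> by \<open>(-a, -b)\<close> describes the same hyperplane, so fixing the direction of the
  inequality still allows \<open>T\<close> to lie in either closed half-space.
\<close>

definition supporting_hyperplane ::
    "'a::euclidean_space set \<Rightarrow> 'a \<Rightarrow> 'a set \<Rightarrow> bool" where
  "supporting_hyperplane T q H \<longleftrightarrow> q \<in> H \<and>
     (\<exists>a b. a \<noteq> 0 \<and> H = {x. a \<bullet> x = b} \<and> T \<subseteq> {x. a \<bullet> x \<le> b})"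

definition outer_unit_normal ::
    "'a::euclidean_space set \<Rightarrow> 'a \<Rightarrow> 'a set \<Rightarrow> 'a \<Rightarrow> bool" where
  "outer_unit_normal T q H \<nu> \<longleftrightarrow>
     norm \<nu> = 1 \<and> H = {x. \<nu> \<bullet> (x - q) = 0} \<and> (\<forall>y\<in>T. \<nu> \<bullet> (y - q) \<le> 0)"

definition reflection_hyperplane ::
    "'a::euclidean_space set \<Rightarrow> nat \<Rightarrow> (nat \<Rightarrow> 'a) \<Rightarrow> nat \<Rightarrow> 'a set \<Rightarrow> bool" where
  "reflection_hyperplane T m p j H \<longleftrightarrow> supporting_hyperplane T (p j) H \<and>
     (\<forall>x\<in>H. norm (p j - p (prev_idx m j)) + norm (p (next_idx m j) - p j)
              \<le> norm (x - p (prev_idx m j)) + norm (p (next_idx m j) - x))"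

definition closed_billiard_trajectory ::
    "'a::euclidean_space set \<Rightarrow> nat \<Rightarrow> (nat \<Rightarrow> 'a) \<Rightarrow> bool" where
  "closed_billiard_trajectory T m p \<longleftrightarrow> closed_polygonal_curve m p \<and>
     (\<forall>j<m. p j \<in> frontier T \<and> (\<exists>H. reflection_hyperplane T m p j H))"

definition length_minimizing_trajectory ::
    "'a::euclidean_space set \<Rightarrow> nat \<Rightarrow> (nat \<Rightarrow> 'a) \<Rightarrow> bool" where
  "length_minimizing_trajectory T m p \<longleftrightarrow> closed_billiard_trajectory T m p \<and>
     (\<forall>k q. closed_billiard_trajectory T k q \<longrightarrow> curve_length m p \<le> curve_length k q)"

definition outer_normal_cone :: "'a::euclidean_space set \<Rightarrow> 'a \<Rightarrow> 'a set" where
  "outer_normal_cone T q = {\<nu>. \<forall>y\<in>T. \<nu> \<bullet> (y - q) \<le> 0}"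

definition affine_section :: "'a::euclidean_space set \<Rightarrow> 'a set \<Rightarrow> bool" where
  "affine_section T S \<longleftrightarrow> (\<exists>W. affine W \<and> S = T \<inter> W)"

definition minimal_affine_section ::
    "'a::euclidean_space set \<Rightarrow> 'a set \<Rightarrow> 'a set \<Rightarrow> bool" where
  "minimal_affine_section T P S \<longleftrightarrow> affine_section T S \<and> P \<subseteq> S \<and>
     (\<forall>S'. affine_section T S' \<and> P \<subseteq> S' \<longrightarrow> S \<subseteq> S')"

text \<open>
  A section \<open>T \<inter> V\<close> need not determine \<open>V\<close>: an edge of a cube is also cut out by a plane meeting
  the cube in that edge only.  The affine subspace belonging to the minimal section containing the
  vertex set \<open>P\<close> is by convention the affine hull of \<open>P\<close>.
\<close>

definition minimal_section_space ::
    "'a::euclidean_space set \<Rightarrow> 'a set \<Rightarrow> 'a set \<Rightarrow> bool" where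
  "minimal_section_space T P V \<longleftrightarrow> V = affine hull P \<and> minimal_affine_section T P (T \<inter> V)"

lemma minimal_section_space_affine_hull:
  assumes "P \<subseteq> T"
  shows "minimal_section_space T P (affine hull P)"
proof -
  have "P \<subseteq> T \<inter> affine hull P"
    using assms by (simp add: hull_subset)
  moreover have "T \<inter> affine hull P \<subseteq> T \<inter> W" if "affine W" "P \<subseteq> T \<inter> W" for W
    using hull_minimal[of P W affine] that by auto
  moreover have "affine (affine hull P)"
    by (rule affine_affine_hull)
  ultimately show ?thesis
    unfolding minimal_section_space_def minimal_affine_section_def affine_section_def by metis
qed

end

theory Submission imports Defs begin

text \<open>
  The reflection rule is the first-order condition of a variational problem.  Say that a curve fits
  if some translation moves its vertices into the interior of \<open>T\<close>.  A curve does not fit as soon as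
  nonzero outer normals at its vertices balance, that is, have \<open>0\<close> in their convex hull, and for curves in \<open>T\<close>
  the converse holds as well (\<open>not_fits_inside_if_normals_balance\<close>,
  \<open>normals_balance_if_not_fits_inside\<close>).  For a given number of vertices, compactness provides a
  shortest curve among those that do not fit, and if this number is as small as possible, the curve
  is, up to translation, a billiard trajectory
  (\<open>billiard_trajectory_not_longer_than_nonfitting_curve\<close>).  Hence a length-minimizing trajectory \<open>p\<close>
  is no longer than any curve that does not fit.

  At each vertex \<open>p j\<close> the turn \<open>w j\<close>, the unit vector of the incoming edge minus that of the
  outgoing one, is a positive multiple of the outer normal of \<open>H j\<close>, and the turns sum to zero.
  Hence the cone \<open>U\<close> of the normals is the linear span of the turns, which is contained in
  \<open>V\<^sub>0\<close>, and \<open>dim V\<^sub>0 \<le> m - 1\<close> because \<open>V\<close> is spanned by \<open>m\<close> points.  If \<open>dim U\<close> were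
  smaller than \<open>m - 1\<close>, then by Caratheodory's theorem fewer than \<open>m\<close> turns would balance, and a
  vertex could be dropped, which shortens the curve but still does not let it fit
  (\<open>dim_span_edge_turns\<close>).  So \<open>U = V\<^sub>0\<close> has dimension \<open>m - 1\<close>.

  Now let \<open>n\<close> be any nonzero normal at \<open>p j\<close> in \<open>V\<^sub>0\<close>.  In a balance that contains \<open>n\<close> and the turns
  at all vertices except one, the missing vertex must be \<open>p j\<close> itself, because no vertex can be
  dropped.  So \<open>n\<close> replaces \<open>w j\<close>, minimality makes \<open>p\<close> reflect at the hyperplane orthogonal to \<open>n\<close>
  too, and \<open>n\<close> is parallel to \<open>w j\<close> (\<open>normal_in_span_edge_turns\<close>).
\<close>

section \<open>Translations into the interior and balanced normals\<close>

definition fits_inside :: "'a::euclidean_space set \<Rightarrow> 'a set \<Rightarrow> bool" where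
  "fits_inside T P \<longleftrightarrow> (\<exists>t. \<forall>x\<in>P. x + t \<in> interior T)"

lemma fits_inside_mono: "fits_inside T P \<Longrightarrow> Q \<subseteq> P \<Longrightarrow> fits_inside T Q"
  unfolding fits_inside_def by blast

lemma fits_inside_translation: "fits_inside T ((\<lambda>x. x + s) ` P) \<longleftrightarrow> fits_inside T P"
proof
  assume "fits_inside T P"
  then obtain t where t: "\<forall>x\<in>P. x + t \<in> interior T"
    unfolding fits_inside_def by blast
  have "\<forall>x\<in>(\<lambda>x. x + s) ` P. x + (t - s) \<in> interior T"
    using t by simp
  then show "fits_inside T ((\<lambda>x. x + s) ` P)"
    unfolding fits_inside_def by blast
next
  assume "fits_inside T ((\<lambda>x. x + s) ` P)"
  then obtain t where "\<forall>x\<in>P. x + s + t \<in> interior T"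
    unfolding fits_inside_def by blast
  then have "\<forall>x\<in>P. x + (s + t) \<in> interior T"
    by (simp add: add.assoc)
  then show "fits_inside T P"
    unfolding fits_inside_def by blast
qed

lemma fits_inside_singleton:
  assumes "billiard_table T"
  shows "fits_inside T {x}"
proof -
  obtain z where "z \<in> interior T"
    using assms unfolding billiard_table_def by blast
  then have "x + (z - x) \<in> interior T"
    by simp
  then show ?thesis
    unfolding fits_inside_def by blast
qed

text \<open>
  Whether a set fits depends only on its convex hull.  This is why a vertex on the segment between
  its neighbours can be dropped from a curve.
\<close>

lemma fits_inside_segment:
  assumes "convex T" "fits_inside T P" "a \<in> P" "b \<in> P" "x \<in> closed_segment a b"
  shows "fits_inside T (insert x P)"
proof -
  obtain t where t: "\<forall>x\<in>P. x + t \<in> interior T"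
    using assms(2) unfolding fits_inside_def by blast
  obtain u where u: "0 \<le> u" "u \<le> 1" "x = (1 - u) *\<^sub>R a + u *\<^sub>R b"
    using assms(5) unfolding closed_segment_def by blast
  have "x + t = (1 - u) *\<^sub>R (a + t) + u *\<^sub>R (b + t)"
    unfolding u(3) by (simp add: algebra_simps)
  also have "\<dots> \<in> interior T"
    using convex_interior[OF assms(1)] t assms(3,4) u(1,2)
    by (intro convexD) auto
  finally show ?thesis
    using t unfolding fits_inside_def by blast
qed

lemma normal_strictly_decreases:
  assumes "n \<in> outer_normal_cone T q" "n \<noteq> 0" "q + t \<in> interior T"
  shows "n \<bullet> t < 0"
proof -
  obtain e where e: "e > 0" "cball (q + t) e \<subseteq> T"
    using assms(3) mem_interior_cball by blast
  define d where "d = (e / norm n) *\<^sub>R n"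
  have "q + t + d \<in> T"
    using e assms(2) by (auto simp: d_def dist_norm intro!: subsetD[OF e(2)])
  then have "n \<bullet> (q + t + d - q) \<le> 0"
    using assms(1) unfolding outer_normal_cone_def by blast
  then have "n \<bullet> t + e / norm n * (n \<bullet> n) \<le> 0"
    by (simp add: d_def inner_simps)
  moreover have "e / norm n * (n \<bullet> n) > 0"
    using e(1) assms(2) by simp
  ultimately show ?thesis
    by linarith
qed

text \<open>
  A translation moving \<open>P\<close> into the interior would have negative inner product with every nonzero
  normal, hence with every convex combination of nonzero normals.  For a point \<open>x\<close> outside \<open>T\<close> the
  nonzero elements of \<^term>\<open>outer_normal_cone T x\<close> are the outer normals of the half-spaces that
  contain \<open>T\<close> and have \<open>x\<close> on their boundary; such points arise when a vertex is moved along a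
  supporting hyperplane.
\<close>

lemma not_fits_inside_if_normals_balance:
  assumes "0 \<in> convex hull (\<Union>x\<in>P. outer_normal_cone T x - {0})"
  shows "\<not> fits_inside T P"
proof
  assume "fits_inside T P"
  then obtain t where t: "\<forall>x\<in>P. x + t \<in> interior T"
    unfolding fits_inside_def by blast
  have "(\<Union>x\<in>P. outer_normal_cone T x - {0}) \<subseteq> {n. t \<bullet> n < 0}"
    using normal_strictly_decreases t by (fastforce simp: inner_commute)
  then have "convex hull (\<Union>x\<in>P. outer_normal_cone T x - {0}) \<subseteq> {n. t \<bullet> n < 0}"
    by (rule hull_minimal) (rule convex_halfspace_lt)
  then show False
    using assms by auto
qed

text \<open>
  If the open ray from \<open>x\<close> in direction \<open>t\<close> missed the interior, a hyperplane separating the two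
  would support \<open>T\<close> at \<open>x\<close>, and its normal would not make an obtuse angle with \<open>t\<close>.
\<close>

lemma enters_interior_along_inward_direction:
  assumes T: "convex T" "interior T \<noteq> {}" and x: "x \<in> T"
    and t: "\<And>n. n \<in> outer_normal_cone T x - {0} \<Longrightarrow> n \<bullet> t < 0"
  shows "\<exists>e>0. \<forall>s. 0 < s \<and> s \<le> e \<longrightarrow> x + s *\<^sub>R t \<in> interior T"
proof (cases "\<exists>e>0. x + e *\<^sub>R t \<in> interior T")
  case True
  then obtain e where e: "e > 0" "x + e *\<^sub>R t \<in> interior T"
    by blast
  have "x + s *\<^sub>R t \<in> interior T" if s: "0 < s" "s \<le> e" for s
    using mem_interior_convex_shrink[OF T(1) e(2) x, of "s / e"] s e(1) by simp
  then show ?thesis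
    using e(1) by blast
next
  case False
  define R where "R = (\<lambda>s. x + s *\<^sub>R t) ` {0<..}"
  have "convex R"
  proof -
    have "convex ((\<lambda>s. s *\<^sub>R t) ` {0<..})"
      by (intro convex_linear_image) (auto intro: linearI simp: scaleR_left_distrib)
    then have "convex ((\<lambda>y. x + y) ` ((\<lambda>s. s *\<^sub>R t) ` {0<..}))"
      by (rule convex_translation)
    then show ?thesis
      by (simp add: R_def image_image)
  qed
  moreover have "interior T \<inter> R = {}"
    using False by (auto simp: R_def)
  moreover have "R \<noteq> {}"
    by (auto simp: R_def)
  ultimately obtain a b where ab: "a \<noteq> 0" "\<forall>y\<in>interior T. a \<bullet> y \<le> b" "\<forall>y\<in>R. a \<bullet> y \<ge> b"
    using separating_hyperplane_sets[of "interior T" R] convex_interior[OF T(1)] T(2) by blast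
  have "closure (interior T) \<subseteq> {y. a \<bullet> y \<le> b}"
    by (rule closure_minimal) (use ab(2) in \<open>auto intro: closed_halfspace_le\<close>)
  then have le: "a \<bullet> y \<le> b" if "y \<in> T" for y
    using that closure_subset[of T] convex_closure_interior[OF T] by blast
  have ge: "a \<bullet> x + s * (a \<bullet> t) \<ge> b" if "s > 0" for s
    using ab(3) that by (auto simp: R_def inner_simps)
  have "a \<bullet> x \<ge> b"
  proof (rule ccontr)
    assume less: "\<not> a \<bullet> x \<ge> b"
    then have "a \<bullet> t > 0"
      using ge[of 1] by simp
    \<comment> \<open>this is half of the parameter at which the ray would cross the level \<open>b\<close>\<close>
    then show False
      using ge[of "(b - a \<bullet> x) / (2 * (a \<bullet> t))"] less by (simp add: field_simps)
  qed
  then have bx: "b = a \<bullet> x"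
    using le[OF x] by simp
  then have "a \<in> outer_normal_cone T x - {0}"
    using le ab(1) by (simp add: outer_normal_cone_def inner_simps)
  then have "a \<bullet> t < 0"
    by (rule t)
  then show ?thesis
    using ge[of 1] bx by simp
qed

text \<open>
  The converse, for finite \<open>P \<subseteq> T\<close>.  The outer unit normals at points of \<open>P\<close> form a compact set; if \<open>0\<close>
  is not in its convex hull, a separating vector gives a direction in which all points of \<open>P\<close>
  enter the interior simultaneously.
\<close>

lemma normals_balance_if_not_fits_inside:
  assumes T: "billiard_table T" and P: "finite P" "P \<subseteq> T" "\<not> fits_inside T P"
  shows "0 \<in> convex hull (\<Union>x\<in>P. outer_normal_cone T x - {0})"
proof (rule ccontr)
  define M where "M = (\<Union>x\<in>P. outer_normal_cone T x \<inter> sphere 0 1)"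
  assume *: "0 \<notin> convex hull (\<Union>x\<in>P. outer_normal_cone T x - {0})"
  have "M \<subseteq> (\<Union>x\<in>P. outer_normal_cone T x - {0})"
    unfolding M_def by auto
  then have 0: "0 \<notin> convex hull M"
    using * hull_mono by blast
  have "closed (outer_normal_cone T x)" for x
  proof -
    have "outer_normal_cone T x = (\<Inter>y\<in>T. {n. (y - x) \<bullet> n \<le> 0})"
      by (auto simp: outer_normal_cone_def inner_commute)
    then show ?thesis
      by (auto intro: closed_halfspace_le)
  qed
  then have "compact M"
    unfolding M_def using P(1) by (intro compact_UN closed_Int_compact compact_sphere)
  then have "closed (convex hull M)"
    by (simp add: compact_convex_hull compact_imp_closed)
  from separating_hyperplane_closed_0[OF convex_convex_hull this 0]
  obtain a b where "0 < b" "\<forall>x\<in>convex hull M. a \<bullet> x > b"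
    by blast
  then have a: "a \<bullet> n > 0" if "n \<in> M" for n
    using that hull_inc[of n M convex] by (metis less_trans)
  have "n \<bullet> (- a) < 0" if "x \<in> P" "n \<in> outer_normal_cone T x - {0}" for x n
  proof -
    have "n /\<^sub>R norm n \<in> M"
      using that by (auto simp: M_def outer_normal_cone_def intro!: bexI[of _ x] mult_nonneg_nonpos)
    from a[OF this] show ?thesis
      using that by (auto simp: inner_commute zero_less_mult_iff)
  qed
  then have "\<forall>x\<in>P. \<exists>e>0. \<forall>s. 0 < s \<and> s \<le> e \<longrightarrow> x + s *\<^sub>R (- a) \<in> interior T"
    using T P(2) unfolding billiard_table_def
    by (intro ballI enters_interior_along_inward_direction) blast+
  then obtain e where e: "\<And>x. x \<in> P \<Longrightarrow> e x > 0"
      "\<And>x s. x \<in> P \<Longrightarrow> 0 < s \<Longrightarrow> s \<le> e x \<Longrightarrow> x + s *\<^sub>R (- a) \<in> interior T"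
    by metis
  define d where "d = Min (insert 1 (e ` P))"
  have "d > 0" "\<And>x. x \<in> P \<Longrightarrow> d \<le> e x"
    unfolding d_def using P(1) e(1) by auto
  then have "\<forall>x\<in>P. x + d *\<^sub>R (- a) \<in> interior T"
    using e(2) by blast
  then show False
    using P(3) unfolding fits_inside_def by blast
qed

text \<open>
  An interior point turns nonvanishing of a normal into a strict linear inequality, so removing the
  origin keeps the cone convex.
\<close>

lemma convex_nonzero_normals:
  assumes "interior T \<noteq> {}"
  shows "convex (outer_normal_cone T x - {0})"
proof -
  obtain z where z: "z \<in> interior T"
    using assms by blast
  have "outer_normal_cone T x - {0} = (\<Inter>y\<in>T. {n. (y - x) \<bullet> n \<le> 0}) \<inter> {n. (z - x) \<bullet> n < 0}"
    using normal_strictly_decreases[of _ T x "z - x"] z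
    by (auto simp: outer_normal_cone_def inner_commute)
  then show ?thesis
    by (auto intro!: convex_Int convex_INT convex_halfspace_le convex_halfspace_lt)
qed

text \<open>
  By convexity of the nonzero normals at \<open>x\<close>, those that take part in the balance can be merged into
  one.  At least one takes part, because \<open>Q\<close> alone fits.
\<close>

lemma balance_with_single_normal:
  assumes T: "billiard_table T" and P: "finite P" "P \<subseteq> T" "\<not> fits_inside T P"
    and less: "Q \<subseteq> P" "P \<subseteq> insert x Q" "fits_inside T Q"
  shows "\<exists>n. n \<in> outer_normal_cone T x \<and> n \<noteq> 0 \<and>
    0 \<in> convex hull (insert n (\<Union>y\<in>Q. outer_normal_cone T y - {0}))"
proof -
  define A where "A = outer_normal_cone T x - {0}"
  define B where "B = (\<Union>y\<in>Q. outer_normal_cone T y - {0})"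
  have A: "convex A"
    unfolding A_def using T by (auto simp: billiard_table_def intro: convex_nonzero_normals)
  have "(\<Union>y\<in>P. outer_normal_cone T y - {0}) \<subseteq> A \<union> B"
    using less(2) by (auto simp: A_def B_def)
  then have 0: "0 \<in> convex hull (A \<union> B)"
    using normals_balance_if_not_fits_inside[OF T P] hull_mono by blast
  have B0: "0 \<notin> convex hull B"
    using not_fits_inside_if_normals_balance less(3) unfolding B_def by blast
  have "A \<noteq> {}"
    using 0 B0 by auto
  moreover have "B \<noteq> {}"
    using 0 A by (auto simp: hull_same A_def)
  moreover have "convex hull (A \<union> B) = convex hull (A \<union> convex hull B)"
    by (rule hull_Un_right)
  ultimately obtain u v a b where ab: "0 = u *\<^sub>R a + v *\<^sub>R b" "0 \<le> u" "0 \<le> v" "u + v = 1"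
      "a \<in> A" "b \<in> convex hull B"
    using 0 convex_hull_union_two[OF A, of "convex hull B"] by auto
  have "a \<in> convex hull (insert a B)" "b \<in> convex hull (insert a B)"
    using ab(6) hull_mono[of B "insert a B" convex] by (auto intro: hull_inc)
  then have "0 \<in> convex hull (insert a B)"
    unfolding ab(1) using ab(2-4) by (intro convexD) auto
  then show ?thesis
    using ab(5) unfolding A_def B_def by blast
qed

section \<open>Lengths of closed curves\<close>

lemma next_idx_less: "j < m \<Longrightarrow> next_idx m j < m"
  unfolding next_idx_def by auto

lemma prev_idx_less: "j < m \<Longrightarrow> prev_idx m j < m"
  unfolding prev_idx_def by auto

lemma prev_next_idx: "j < m \<Longrightarrow> prev_idx m (next_idx m j) = j"
  unfolding next_idx_def prev_idx_def by (cases "Suc j = m") auto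

lemma next_prev_idx: "j < m \<Longrightarrow> next_idx m (prev_idx m j) = j"
  unfolding next_idx_def prev_idx_def by (cases j) (auto simp: mod_Suc)

lemma neighbour_idx_neq:
  assumes "2 \<le> m" "i < m"
  shows "prev_idx m i \<noteq> i" "next_idx m i \<noteq> i"
  using assms by (cases i; auto simp: prev_idx_def next_idx_def mod_Suc split: if_splits)+

lemma sum_next_idx: "(\<Sum>j<m. f (next_idx m j)) = (\<Sum>j<m. f j :: 'a::comm_monoid_add)"
proof (cases m)
  case (Suc n)
  have "(\<Sum>j<m. f (next_idx m j)) = (\<Sum>j<n. f (Suc j)) + f 0"
    unfolding Suc by (simp add: next_idx_def)
  also have "\<dots> = (\<Sum>j<m. f j)"
    unfolding Suc by (subst sum.lessThan_Suc_shift) (simp add: add.commute)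
  finally show ?thesis .
qed simp

lemma curve_length_cong:
  assumes "\<And>j. j < m \<Longrightarrow> p j = q j"
  shows "curve_length m p = curve_length m q"
  unfolding curve_length_def using assms next_idx_less by (intro sum.cong) auto

lemma curve_length_Suc:
  "curve_length (Suc n) p = (\<Sum>j<n. norm (p (Suc j) - p j)) + norm (p 0 - p n)"
  unfolding curve_length_def by (simp add: next_idx_def)

lemma curve_length_translation: "curve_length m (\<lambda>j. p j + t) = curve_length m p"
  unfolding curve_length_def by simp

lemma curve_length_scale: "curve_length m (\<lambda>j. c *\<^sub>R p j) = \<bar>c\<bar> * curve_length m p"
  unfolding curve_length_def by (simp add: sum_distrib_left flip: scaleR_diff_right)

lemma curve_length_rotate:
  "curve_length m (\<lambda>j. p ((s + j) mod m)) = curve_length m p"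
proof (induction s)
  case 0
  show ?case
    by (rule curve_length_cong) simp
next
  case (Suc s)
  define r where "r = (\<lambda>j. p ((s + j) mod m))"
  have "curve_length m (\<lambda>j. p ((Suc s + j) mod m)) = curve_length m (\<lambda>j. r (next_idx m j))"
    by (rule curve_length_cong) (simp add: r_def next_idx_def mod_simps)
  also have "\<dots> = curve_length m r"
    unfolding curve_length_def by (rule sum_next_idx[of "\<lambda>j. norm (r (next_idx m j) - r j)"])
  finally show ?case
    using Suc by (simp add: r_def)
qed

text \<open>
  This bounds a curve, up to translation, by its length, which provides the compactness below.
\<close>

lemma vertex_distance_le_curve_length:
  assumes "i < m"
  shows "norm (p i - p 0) \<le> curve_length m p"
proof -
  obtain n where m: "m = Suc n"
    using assms by (cases m) auto
  have "norm (p i - p 0) = norm (\<Sum>j<i. p (Suc j) - p j)"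
    by (simp add: sum_lessThan_telescope)
  also have "\<dots> \<le> (\<Sum>j<i. norm (p (Suc j) - p j))"
    by (rule norm_sum)
  also have "\<dots> \<le> (\<Sum>j<n. norm (p (Suc j) - p j))"
    using assms m by (intro sum_mono2) auto
  finally show ?thesis
    unfolding m curve_length_Suc by (simp add: add_increasing2)
qed

text \<open>
  The remaining vertices are listed from the successor of the deleted one, so that the deletion is
  a rotation followed by dropping the last vertex.
\<close>

definition delete_vertex :: "nat \<Rightarrow> nat \<Rightarrow> (nat \<Rightarrow> 'a) \<Rightarrow> nat \<Rightarrow> 'a" where
  "delete_vertex m i p j = p ((i + 1 + j) mod m)"

lemma image_delete_vertex:
  assumes "i < m"
  shows "p ` ({..<m} - {i}) \<subseteq> delete_vertex m i p ` {..<m - 1}"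
proof
  fix x
  assume "x \<in> p ` ({..<m} - {i})"
  then obtain k where k: "k < m" "k \<noteq> i" "x = p k"
    by auto
  define j where "j = (if i < k then k - i - 1 else m - i - 1 + k)"
  have "j < m - 1" "(i + 1 + j) mod m = k"
    using k assms by (auto simp: j_def)
  then show "x \<in> delete_vertex m i p ` {..<m - 1}"
    using k by (auto simp: delete_vertex_def intro!: image_eqI[of _ _ j])
qed

lemma curve_length_delete_vertex:
  assumes "2 \<le> m" "i < m"
  shows "curve_length m p = curve_length (m - 1) (delete_vertex m i p)
    + norm (p i - p (prev_idx m i)) + norm (p (next_idx m i) - p i)
    - norm (p (next_idx m i) - p (prev_idx m i))"
proof -
  obtain n where m: "m = Suc (Suc n)"
    using assms(1) by (metis add_2_eq_Suc le_Suc_ex)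
  define r where "r = delete_vertex m i p"
  have "i + 1 + Suc n = i + m"
    by (simp add: m)
  then have "(i + 1 + Suc n) mod m = i"
    using assms(2) by (simp only: mod_add_self2 mod_less)
  then have r: "r 0 = p (next_idx m i)" "r n = p (prev_idx m i)" "r (Suc n) = p i"
    unfolding r_def delete_vertex_def by (simp_all add: next_idx_def prev_idx_def m)
  have "curve_length m p = curve_length m r"
    unfolding r_def delete_vertex_def[abs_def] by (simp only: curve_length_rotate)
  also have "\<dots> = curve_length (m - 1) r - norm (r 0 - r n)
      + norm (r (Suc n) - r n) + norm (r 0 - r (Suc n))"
    by (simp add: m curve_length_Suc)
  finally show ?thesis
    unfolding r by (simp add: r_def)
qed

lemma curve_length_delete_vertex_le:
  assumes "2 \<le> m" "i < m"
  shows "curve_length (m - 1) (delete_vertex m i p) \<le> curve_length m p"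
  using curve_length_delete_vertex[OF assms, of p]
    norm_triangle_ineq[of "p (next_idx m i) - p i" "p i - p (prev_idx m i)"]
  by simp

lemma curve_length_delete_vertex_less:
  assumes "2 \<le> m" "i < m" "p i \<notin> closed_segment (p (prev_idx m i)) (p (next_idx m i))"
  shows "curve_length (m - 1) (delete_vertex m i p) < curve_length m p"
proof -
  have "dist (p (prev_idx m i)) (p (next_idx m i))
      < dist (p (prev_idx m i)) (p i) + dist (p i) (p (next_idx m i))"
    using assms(3) dist_triangle[of "p (prev_idx m i)" "p (next_idx m i)" "p i"]
    unfolding between_mem_segment[symmetric] between by linarith
  then show ?thesis
    using curve_length_delete_vertex[OF assms(1,2), of p] by (simp add: dist_norm norm_minus_commute)
qed

text \<open>
  Both curves have the same rest after deletion of vertex \<open>i\<close>.  Hence comparing total lengths is the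
  same as comparing the two edges at that vertex, which is what the reflection rule is about.
\<close>

lemma curve_length_move_vertex:
  assumes "2 \<le> m" "i < m"
  shows "curve_length m (p(i := y)) - (norm (y - p (prev_idx m i)) + norm (p (next_idx m i) - y))
    = curve_length m p - (norm (p i - p (prev_idx m i)) + norm (p (next_idx m i) - p i))"
proof -
  note ne = neighbour_idx_neq[OF assms]
  have ne': "(i + 1 + j) mod m \<noteq> i" if "j < m - 1" for j
    using that assms by (cases "i + 1 + j < m") (auto simp: mod_if)
  have "curve_length (m - 1) (delete_vertex m i (p(i := y))) = curve_length (m - 1) (delete_vertex m i p)"
    by (rule curve_length_cong) (use ne' in \<open>auto simp: delete_vertex_def\<close>)
  then show ?thesis
    using curve_length_delete_vertex[OF assms, of p] curve_length_delete_vertex[OF assms, of "p(i := y)"] ne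
    by simp
qed

section \<open>Shortest curves that do not fit\<close>

text \<open>
  Curves are points of the product space \<^typ>\<open>nat \<Rightarrow> 'a\<close>; the condition involves finitely many
  coordinates and is open in each.
\<close>

lemma open_fitting_curves: "open {x. fits_inside T (x ` {..<k::nat})}"
proof -
  have "{x. fits_inside T (x ` {..<k})} = (\<Union>t. \<Inter>i<k. (\<lambda>x. x i + t) -` interior T)"
    by (auto simp: fits_inside_def)
  moreover have "open ((\<lambda>x::nat \<Rightarrow> 'a. x i + t) -` interior T)" for i t
    by (intro open_vimage open_interior continuous_intros continuous_on_product_coordinates)
  ultimately show ?thesis
    by (auto intro!: open_UN open_INT)
qed

text \<open>
  Translating the first vertex to the origin and setting the irrelevant values to \<open>0\<close> puts every
  competitor of length at most \<open>L\<close> into a product of balls of radius \<open>L\<close>, which is compact.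
\<close>

lemma shortest_nonfitting_curve_exists:
  fixes q :: "nat \<Rightarrow> 'a::euclidean_space"
  assumes "\<not> fits_inside T (q ` {..<k})"
  shows "\<exists>x. \<not> fits_inside T (x ` {..<k}) \<and>
    (\<forall>y. \<not> fits_inside T (y ` {..<k}) \<longrightarrow> curve_length k x \<le> curve_length k y)"
proof -
  define L where "L = curve_length k q"
  define D :: "(nat \<Rightarrow> 'a) set" where "D = Pi\<^sub>E UNIV (\<lambda>_. cball 0 L)"
  define C where "C = D - {x. fits_inside T (x ` {..<k})}"
  define N where "N y j = (if j < k then y j + (- y 0) else 0)" for y :: "nat \<Rightarrow> 'a" and j
  have "compactin (product_topology (\<lambda>_. euclidean) UNIV) D"
    unfolding D_def compactin_PiE by simp
  then have "compact D"
    by (simp add: euclidean_product_topology)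
  then have "compact C"
    unfolding C_def by (intro compact_diff open_fitting_curves)
  have N_length: "curve_length k (N y) = curve_length k y" for y
  proof -
    have "curve_length k (N y) = curve_length k (\<lambda>j. y j + (- y 0))"
      by (rule curve_length_cong) (simp add: N_def)
    then show ?thesis
      by (simp only: curve_length_translation)
  qed
  have NC: "N y \<in> C" if y: "\<not> fits_inside T (y ` {..<k})" "curve_length k y \<le> L" for y
  proof -
    have "N y ` {..<k} = (\<lambda>x. x + (- y 0)) ` (y ` {..<k})"
      unfolding image_image by (intro image_cong) (auto simp: N_def)
    then have "\<not> fits_inside T (N y ` {..<k})"
      using y(1) by (simp only: fits_inside_translation not_False_eq_True)
    moreover have "0 \<le> L"
      unfolding L_def curve_length_def by (simp add: sum_nonneg)
    then have "norm (N y j) \<le> L" for j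
      using vertex_distance_le_curve_length[of j k y] y(2) by (auto simp: N_def)
    ultimately show ?thesis
      by (simp add: C_def D_def PiE_iff)
  qed
  have "continuous_on C (curve_length k)"
    unfolding curve_length_def[abs_def]
    by (intro continuous_intros continuous_on_subset[OF continuous_on_product_coordinates]) auto
  moreover have "C \<noteq> {}"
    using NC[of q] assms by (auto simp: L_def)
  ultimately obtain x where x: "x \<in> C" "\<And>y. y \<in> C \<Longrightarrow> curve_length k x \<le> curve_length k y"
    using continuous_attains_inf[OF \<open>compact C\<close>] by blast
  have "curve_length k x \<le> curve_length k y" if y: "\<not> fits_inside T (y ` {..<k})" for y
  proof (cases "curve_length k y \<le> L")
    case True
    then show ?thesis
      using x(2)[OF NC[OF y]] N_length by simp
  next
    case False
    have "curve_length k x \<le> L"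
      using x(2)[OF NC[of q]] assms N_length by (simp add: L_def)
    then show ?thesis
      using False by simp
  qed
  then show ?thesis
    using x(1) by (auto simp: C_def)
qed

text \<open>
  The length is positive, because a constant curve fits.  Hence shrinking the curve by any factor
  below 1 shortens it, so that it fits by minimality.  The
  translations of the shrunken curves accumulate, and in the limit the curve itself is moved
  into \<open>T\<close> (though not into its interior).
\<close>

lemma shortest_nonfitting_curve_moves_into_table:
  assumes T: "billiard_table T" and x: "\<not> fits_inside T (x ` {..<k})"
    and min: "\<And>y. \<not> fits_inside T (y ` {..<k}) \<Longrightarrow> curve_length k x \<le> curve_length k y"
  shows "\<exists>t. \<forall>i<k. x i + t \<in> T"
proof -
  have "k > 0"
    using x by (cases k) (auto simp: fits_inside_def)
  have L: "curve_length k x > 0"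
  proof (rule ccontr)
    assume *: "\<not> curve_length k x > 0"
    have "x i = x 0" if "i < k" for i
    proof -
      have "norm (x i - x 0) \<le> 0"
        using vertex_distance_le_curve_length[OF that, of x] * by linarith
      then show ?thesis
        by simp
    qed
    then have "x ` {..<k} \<subseteq> {x 0}"
      by blast
    then show False
      using x fits_inside_mono[OF fits_inside_singleton[OF T]] by blast
  qed
  define c :: "nat \<Rightarrow> real" where "c N = 1 - inverse (real (Suc N))" for N
  have "fits_inside T ((\<lambda>i. c N *\<^sub>R x i) ` {..<k})" for N
  proof (rule ccontr)
    assume "\<not> ?thesis"
    then have "curve_length k x \<le> c N * curve_length k x"
      using min[of "\<lambda>i. c N *\<^sub>R x i"] by (simp add: curve_length_scale c_def field_simps)
    moreover have "c N < 1"
      by (simp add: c_def)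
    ultimately show False
      using L by simp
  qed
  then have "\<forall>N. \<exists>t. \<forall>i<k. c N *\<^sub>R x i + t \<in> T"
    unfolding fits_inside_def using interior_subset by fastforce
  then obtain t where t: "\<And>N i. i < k \<Longrightarrow> c N *\<^sub>R x i + t N \<in> T"
    by metis
  define s where "s N = c N *\<^sub>R x 0 + t N" for N
  have "compact T"
    using T by (simp add: billiard_table_def)
  then obtain l r where r: "strict_mono (r :: nat \<Rightarrow> nat)" "(s \<circ> r) \<longlonglongrightarrow> l"
    using t[OF \<open>k > 0\<close>] unfolding compact_def s_def by meson
  have "c \<longlonglongrightarrow> 1 - 0"
    unfolding c_def by (intro tendsto_intros LIMSEQ_inverse_real_of_nat)
  then have c: "(c \<circ> r) \<longlonglongrightarrow> 1"
    using r(1) by (simp add: LIMSEQ_subseq_LIMSEQ)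
  have "x i + (l - x 0) \<in> T" if i: "i < k" for i
  proof -
    have "(\<lambda>N. (s \<circ> r) N + (c \<circ> r) N *\<^sub>R (x i - x 0)) \<longlonglongrightarrow> l + 1 *\<^sub>R (x i - x 0)"
      by (intro tendsto_intros r(2) c)
    moreover have "(s \<circ> r) N + (c \<circ> r) N *\<^sub>R (x i - x 0) \<in> T" for N
      using t[OF i, of "r N"] by (simp add: s_def algebra_simps)
    ultimately have "l + 1 *\<^sub>R (x i - x 0) \<in> T"
      by (rule closed_sequentially[OF compact_imp_closed[OF \<open>compact T\<close>], rotated])
    then show ?thesis
      by (simp add: algebra_simps)
  qed
  then show ?thesis
    by blast
qed

lemma reflection_at_normal_of_shortest_curve:
  assumes "2 \<le> m" "i < m" "n \<in> outer_normal_cone T (p i)" "n \<noteq> 0"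
    and min: "\<And>y. n \<bullet> (y - p i) = 0 \<Longrightarrow> curve_length m p \<le> curve_length m (p(i := y))"
  shows "reflection_hyperplane T m p i {y. n \<bullet> (y - p i) = 0}"
proof -
  have "{y. n \<bullet> (y - p i) = 0} = {y. n \<bullet> y = n \<bullet> p i}" "T \<subseteq> {y. n \<bullet> y \<le> n \<bullet> p i}"
    using assms(3) by (auto simp: outer_normal_cone_def inner_diff_right)
  then have "supporting_hyperplane T (p i) {y. n \<bullet> (y - p i) = 0}"
    unfolding supporting_hyperplane_def using assms(4) by auto
  moreover have "norm (p i - p (prev_idx m i)) + norm (p (next_idx m i) - p i)
      \<le> norm (y - p (prev_idx m i)) + norm (p (next_idx m i) - y)" if "n \<bullet> (y - p i) = 0" for y
    using min[OF that] curve_length_move_vertex[OF assms(1,2), of p y] by linarith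
  ultimately show ?thesis
    unfolding reflection_hyperplane_def by blast
qed

text \<open>
  The variational principle of K. Bezdek and D. Bezdek.  Among the curves that do not fit and are
  no longer than \<open>q\<close>, take one with the least number of vertices and, for this number, of least
  length, translated into \<open>T\<close>.  Then no vertex can be dropped, so none lies between its neighbours
  and each contributes a nonzero normal to the balance.  Moving a vertex along the hyperplane
  orthogonal to that normal preserves the balance, so the moved curve still does not fit and is not
  shorter; this is the reflection rule.
\<close>

lemma billiard_trajectory_not_longer_than_nonfitting_curve:
  assumes T: "billiard_table T" and q: "\<not> fits_inside T (q ` {..<k})"
  shows "\<exists>m x. closed_billiard_trajectory T m x \<and> curve_length m x \<le> curve_length k q"
proof -
  define good where "good m \<longleftrightarrow> (\<exists>y. \<not> fits_inside T (y ` {..<m}) \<and> curve_length m y \<le> curve_length k q)"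
    for m
  have "good k"
    using q by (auto simp: good_def)
  define m where "m = (LEAST m. good m)"
  have "good m"
    unfolding m_def by (rule LeastI[of good, OF \<open>good k\<close>])
  have least: "\<not> good j" if "j < m" for j
    using that not_less_Least unfolding m_def by blast
  obtain y where y: "\<not> fits_inside T (y ` {..<m})" "curve_length m y \<le> curve_length k q"
    using \<open>good m\<close> by (auto simp: good_def)
  obtain z where z: "\<not> fits_inside T (z ` {..<m})"
      "\<And>y. \<not> fits_inside T (y ` {..<m}) \<Longrightarrow> curve_length m z \<le> curve_length m y"
    using shortest_nonfitting_curve_exists[OF y(1)] by blast
  obtain t where t: "\<forall>i<m. z i + t \<in> T"
    using shortest_nonfitting_curve_moves_into_table[OF T z] by blast
  define x where "x i = z i + t" for i
  have "x ` {..<m} = (\<lambda>y. y + t) ` (z ` {..<m})"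
    by (simp add: x_def image_image)
  then have x_out: "\<not> fits_inside T (x ` {..<m})"
    using z(1) by (simp only: fits_inside_translation not_False_eq_True)
  have x_min: "curve_length m x \<le> curve_length m y" if "\<not> fits_inside T (y ` {..<m})" for y
    using z(2)[OF that] curve_length_translation[of m z t] by (simp add: x_def[abs_def])
  have x_le: "curve_length m x \<le> curve_length k q"
    using x_min[OF y(1)] y(2) by simp
  have x_in: "x ` {..<m} \<subseteq> T"
    using t by (auto simp: x_def)
  have "m \<noteq> 0" "m \<noteq> 1"
    using x_out fits_inside_singleton[OF T, of "x 0"]
    by (auto simp: fits_inside_def lessThan_Suc)
  then have m: "2 \<le> m"
    by simp
  have fits: "fits_inside T (x ` ({..<m} - {i}))" if i: "i < m" for i
  proof (rule ccontr)
    assume "\<not> ?thesis"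
    then have "\<not> fits_inside T (delete_vertex m i x ` {..<m - 1})"
      using fits_inside_mono[OF _ image_delete_vertex[OF i]] by blast
    moreover have "curve_length (m - 1) (delete_vertex m i x) \<le> curve_length k q"
      using curve_length_delete_vertex_le[OF m i, of x] x_le by linarith
    ultimately have "good (m - 1)"
      unfolding good_def by blast
    then show False
      using least m by simp
  qed
  have x_image: "x ` {..<m} = insert (x i) (x ` ({..<m} - {i}))" if "i < m" for i
    using that by auto
  have seg: "x i \<notin> closed_segment (x (prev_idx m i)) (x (next_idx m i))" if i: "i < m" for i
  proof
    assume *: "x i \<in> closed_segment (x (prev_idx m i)) (x (next_idx m i))"
    have "fits_inside T (insert (x i) (x ` ({..<m} - {i})))"
      using T fits[OF i] * next_idx_less[OF i] prev_idx_less[OF i] neighbour_idx_neq[OF m i]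
      by (intro fits_inside_segment[of T _ "x (prev_idx m i)" "x (next_idx m i)"])
        (auto simp: billiard_table_def)
    then show False
      using x_out x_image[OF i] by simp
  qed
  have ne: "x i \<noteq> x (next_idx m i)" if i: "i < m" for i
    using seg[OF next_idx_less[OF i]] prev_next_idx[OF i] by auto
  have refl: "x i \<in> frontier T \<and> (\<exists>H. reflection_hyperplane T m x i H)" if i: "i < m" for i
  proof -
    obtain n where n: "n \<in> outer_normal_cone T (x i)" "n \<noteq> 0"
        "0 \<in> convex hull (insert n (\<Union>y\<in>x ` ({..<m} - {i}). outer_normal_cone T y - {0}))"
      using balance_with_single_normal[OF T _ x_in x_out _ _ fits[OF i], of "x i"] x_image[OF i] by auto
    have "curve_length m x \<le> curve_length m (x(i := y))" if y: "n \<bullet> (y - x i) = 0" for y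
    proof (rule x_min)
      have "n \<bullet> (v - y) = n \<bullet> (v - x i)" for v
        using y by (simp add: inner_diff_right)
      then have "n \<in> outer_normal_cone T y"
        using n(1) by (simp add: outer_normal_cone_def)
      moreover have "(x(i := y)) ` {..<m} = insert y (x ` ({..<m} - {i}))"
        using i by auto
      ultimately have "insert n (\<Union>y\<in>x ` ({..<m} - {i}). outer_normal_cone T y - {0})
          \<subseteq> (\<Union>y\<in>(x(i := y)) ` {..<m}. outer_normal_cone T y - {0})"
        using n(2) by auto
      then show "\<not> fits_inside T ((x(i := y)) ` {..<m})"
        using n(3) hull_mono not_fits_inside_if_normals_balance by blast
    qed
    then have "reflection_hyperplane T m x i {y. n \<bullet> (y - x i) = 0}"
      by (rule reflection_at_normal_of_shortest_curve[where p = x, OF m i n(1,2)])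
    moreover have "x i \<notin> interior T"
      using normal_strictly_decreases[OF n(1,2), of 0] by auto
    then have "x i \<in> frontier T"
      using x_in i closure_subset[of T] by (auto simp: frontier_def)
    ultimately show ?thesis
      by blast
  qed
  have "closed_billiard_trajectory T m x"
    using m seg ne refl by (auto simp: closed_billiard_trajectory_def closed_polygonal_curve_def)
  then show ?thesis
    using x_le by blast
qed

section \<open>Turns and the reflection rule\<close>

text \<open>
  The change of direction at a vertex; by the reflection rule it is a positive multiple of the outer
  normal there.
\<close>

definition edge_turn :: "nat \<Rightarrow> (nat \<Rightarrow> 'a::euclidean_space) \<Rightarrow> nat \<Rightarrow> 'a" where
  "edge_turn m p j = sgn (p j - p (prev_idx m j)) - sgn (p (next_idx m j) - p j)"

lemma sum_edge_turn: "(\<Sum>j<m. edge_turn m p j) = 0"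
proof -
  define u where "u j = sgn (p (next_idx m j) - p j)" for j
  have "(\<Sum>j<m. edge_turn m p j) = (\<Sum>j<m. edge_turn m p (next_idx m j))"
    by (rule sum_next_idx[symmetric])
  also have "\<dots> = (\<Sum>j<m. u j - u (next_idx m j))"
    by (rule sum.cong) (auto simp: edge_turn_def u_def prev_next_idx)
  also have "\<dots> = 0"
    by (simp add: sum_subtractf sum_next_idx)
  finally show ?thesis .
qed

text \<open>
  The first-order condition for the constrained minimum says that the difference of the two unit
  vectors is orthogonal to the hyperplane.  Its sign is fixed because both neighbours lie in the
  half-space \<open>{y. n \<bullet> (y - x) \<le> 0}\<close>, and it does not vanish because otherwise the path would
  go straight through \<open>x\<close>.
\<close>

lemma reflection_direction:
  fixes x a b n :: "'a::euclidean_space"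
  assumes n: "n \<noteq> 0" "n \<bullet> (a - x) \<le> 0" "n \<bullet> (b - x) \<le> 0"
    and seg: "x \<notin> closed_segment a b"
    and min: "\<And>y. n \<bullet> (y - x) = 0 \<Longrightarrow> norm (x - a) + norm (b - x) \<le> norm (y - a) + norm (b - y)"
  shows "\<exists>c>0. sgn (x - a) - sgn (b - x) = c *\<^sub>R n"
proof -
  define w where "w = sgn (x - a) - sgn (b - x)"
  have ne: "x - a \<noteq> 0" "b - x \<noteq> 0"
    using seg by auto
  have orth: "d \<bullet> w = 0" if d: "n \<bullet> d = 0" for d
  proof -
    define f where "f s = norm (x + s *\<^sub>R d - a) + norm (b - (x + s *\<^sub>R d))" for s
    have 1: "((\<lambda>s. norm (x + s *\<^sub>R d - a)) has_derivative (\<lambda>s. (s *\<^sub>R d) \<bullet> sgn (x - a))) (at 0)"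
    proof -
      have 1: "((\<lambda>s. x + s *\<^sub>R d - a) has_derivative (\<lambda>s. s *\<^sub>R d)) (at 0)"
        by (auto intro!: derivative_eq_intros)
      have 2: "(norm has_derivative (\<lambda>h. h \<bullet> sgn (x - a))) (at (x + 0 *\<^sub>R d - a))"
        using has_derivative_norm[OF ne(1)] by simp
      from has_derivative_compose[OF 1 2] show ?thesis .
    qed
    have 2: "((\<lambda>s. norm (b - (x + s *\<^sub>R d))) has_derivative (\<lambda>s. (- (s *\<^sub>R d)) \<bullet> sgn (b - x))) (at 0)"
    proof -
      have 1: "((\<lambda>s. b - (x + s *\<^sub>R d)) has_derivative (\<lambda>s. - (s *\<^sub>R d))) (at 0)"
        by (auto intro!: derivative_eq_intros)
      have 2: "(norm has_derivative (\<lambda>h. h \<bullet> sgn (b - x))) (at (b - (x + 0 *\<^sub>R d)))"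
        using has_derivative_norm[OF ne(2)] by simp
      from has_derivative_compose[OF 1 2] show ?thesis .
    qed
    have "(f has_derivative (\<lambda>s. (s *\<^sub>R d) \<bullet> sgn (x - a) + (- (s *\<^sub>R d)) \<bullet> sgn (b - x))) (at 0)"
      unfolding f_def[abs_def] by (rule has_derivative_add[OF 1 2])
    also have "(\<lambda>s. (s *\<^sub>R d) \<bullet> sgn (x - a) + (- (s *\<^sub>R d)) \<bullet> sgn (b - x)) = (*) (d \<bullet> w)"
      by (rule ext) (simp add: w_def inner_diff_right right_diff_distrib mult.commute)
    finally have "DERIV f 0 :> d \<bullet> w"
      by (simp add: has_field_derivative_def)
    moreover have "f 0 \<le> f s" for s
      using min[of "x + s *\<^sub>R d"] d by (simp add: f_def)
    ultimately show ?thesis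
      using DERIV_local_min[of f "d \<bullet> w" 0 1] by simp
  qed
  define c where "c = (n \<bullet> w) / (n \<bullet> n)"
  have "n \<bullet> (w - c *\<^sub>R n) = 0"
    using n(1) by (simp add: c_def inner_diff_right)
  moreover from orth[OF this] have "(w - c *\<^sub>R n) \<bullet> w = 0" .
  ultimately have "(w - c *\<^sub>R n) \<bullet> (w - c *\<^sub>R n) = 0"
    by (simp add: inner_diff_right inner_commute)
  then have w: "w = c *\<^sub>R n"
    by simp
  have "n \<bullet> w \<ge> 0"
  proof -
    have "0 \<le> inverse (norm (x - a)) * (n \<bullet> (x - a))" "inverse (norm (b - x)) * (n \<bullet> (b - x)) \<le> 0"
      using n(2,3) by (auto intro!: mult_nonneg_nonneg mult_nonneg_nonpos simp: inner_diff_right)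
    then have "0 \<le> n \<bullet> sgn (x - a)" "n \<bullet> sgn (b - x) \<le> 0"
      by (simp_all only: sgn_div_norm inner_scaleR_right)
    then show ?thesis
      by (simp add: w_def inner_diff_right)
  qed
  then have "c \<ge> 0"
    by (simp add: c_def)
  moreover have "c \<noteq> 0"
  proof
    assume "c = 0"
    then have eq: "sgn (x - a) = sgn (b - x)"
      using w by (simp add: w_def)
    define s where "s = norm (x - a) + norm (b - x)"
    have s: "s > 0"
      using ne by (simp add: s_def add_pos_pos)
    define e where "e = sgn (x - a)"
    have xa: "x - a = norm (x - a) *\<^sub>R e"
      using ne(1) by (simp add: e_def sgn_div_norm)
    have bx: "b - x = norm (b - x) *\<^sub>R e"
      unfolding e_def eq using ne(2) by (simp add: sgn_div_norm)
    have "b - a = (x - a) + (b - x)"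
      by simp
    also have "\<dots> = norm (x - a) *\<^sub>R e + norm (b - x) *\<^sub>R e"
      using xa bx by (rule arg_cong2)
    finally have ba: "b - a = s *\<^sub>R e"
      by (simp add: s_def scaleR_left_distrib)
    have "(norm (x - a) / s) *\<^sub>R (b - a) = x - a"
      unfolding ba using s xa by simp
    then have "x = a + (norm (x - a) / s) *\<^sub>R (b - a)"
      by simp
    then have "x = (1 - norm (x - a) / s) *\<^sub>R a + (norm (x - a) / s) *\<^sub>R b"
      by (simp add: algebra_simps)
    moreover have "0 \<le> norm (x - a) / s" "norm (x - a) / s \<le> 1"
      using s by (auto simp: s_def)
    ultimately show False
      using seg unfolding closed_segment_def by blast
  qed
  ultimately show ?thesis
    using w unfolding w_def by (intro exI[of _ c]) auto
qed

text \<open>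
  Since the \<open>w k\<close> sum to zero, the least coefficient may be subtracted from all of them.
\<close>

lemma nonneg_representation_in_span:
  fixes w :: "nat \<Rightarrow> 'a::euclidean_space"
  assumes m: "m > 0" and w: "(\<Sum>k<m. w k) = 0" and x: "x \<in> span (w ` {..<m})"
  shows "\<exists>a. (\<forall>k<m. 0 \<le> a k) \<and> (\<exists>i<m. a i = 0) \<and> x = (\<Sum>k<m. a k *\<^sub>R w k)"
proof -
  have "\<exists>a. x = (\<Sum>k<m. a k *\<^sub>R w k)"
    using x
  proof (induction rule: span_induct_alt)
    case base
    show ?case
      by (rule exI[of _ "\<lambda>_. 0"]) simp
  next
    case (step c y z)
    then obtain i a where i: "i < m" "y = w i" and a: "z = (\<Sum>k<m. a k *\<^sub>R w k)"
      by auto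
    have "(\<Sum>k<m. (a k + (if k = i then c else 0)) *\<^sub>R w k) = z + (\<Sum>k<m. (if k = i then c *\<^sub>R w k else 0))"
      unfolding a sum.distrib[symmetric] by (rule sum.cong) (auto simp: scaleR_left_distrib)
    also have "\<dots> = c *\<^sub>R y + z"
      using i by simp
    finally show ?case
      by metis
  qed
  then obtain a where a: "x = (\<Sum>k<m. a k *\<^sub>R w k)"
    by blast
  define \<mu> where "\<mu> = Min (a ` {..<m})"
  have "\<mu> \<in> a ` {..<m}"
    unfolding \<mu>_def using m by (intro Min_in) auto
  then obtain i where i: "i < m" "a i = \<mu>"
    by auto
  have "\<mu> \<le> a k" if "k < m" for k
    unfolding \<mu>_def using that by simp
  moreover have "x = (\<Sum>k<m. (a k - \<mu>) *\<^sub>R w k)"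
    using w by (simp add: a scaleR_left_diff_distrib sum_subtractf flip: scaleR_sum_right)
  ultimately show ?thesis
    using i by (intro exI[of _ "\<lambda>k. a k - \<mu>"]) auto
qed

section \<open>Length-minimizing billiard trajectories\<close>

lemma shortest_trajectory_le_nonfitting_curve:
  assumes "billiard_table T" "length_minimizing_trajectory T m p" "\<not> fits_inside T (q ` {..<k})"
  shows "curve_length m p \<le> curve_length k q"
  using billiard_trajectory_not_longer_than_nonfitting_curve[OF assms(1,3)] assms(2)
  unfolding length_minimizing_trajectory_def by (meson order_trans)

text \<open>
  Dropping a vertex shortens the curve strictly, so the shorter curve cannot be a competitor.
\<close>

lemma shortest_trajectory_fits_without_vertex:
  assumes T: "billiard_table T" and p: "length_minimizing_trajectory T m p" and i: "i < m"
  shows "fits_inside T (p ` ({..<m} - {i}))"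
proof (rule ccontr)
  assume "\<not> ?thesis"
  then have "\<not> fits_inside T (delete_vertex m i p ` {..<m - 1})"
    using fits_inside_mono[OF _ image_delete_vertex[OF i]] by blast
  then have "curve_length m p \<le> curve_length (m - 1) (delete_vertex m i p)"
    by (rule shortest_trajectory_le_nonfitting_curve[OF T p])
  moreover have "curve_length (m - 1) (delete_vertex m i p) < curve_length m p"
    using p i by (intro curve_length_delete_vertex_less)
      (auto simp: length_minimizing_trajectory_def closed_billiard_trajectory_def closed_polygonal_curve_def)
  ultimately show False
    by simp
qed

lemma edge_turn_of_reflection:
  assumes p: "closed_billiard_trajectory T m p" and T: "closed T" and j: "j < m"
    and n: "n \<in> outer_normal_cone T (p j)" "n \<noteq> 0"
    and refl: "reflection_hyperplane T m p j {y. n \<bullet> (y - p j) = 0}"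
  shows "\<exists>c>0. edge_turn m p j = c *\<^sub>R n"
proof -
  have "p k \<in> T" if "k < m" for k
    using p that frontier_subset_eq[of T] T unfolding closed_billiard_trajectory_def by blast
  then have "n \<bullet> (p (prev_idx m j) - p j) \<le> 0" "n \<bullet> (p (next_idx m j) - p j) \<le> 0"
    using n(1) next_idx_less[OF j] prev_idx_less[OF j] by (simp_all add: outer_normal_cone_def)
  moreover have "p j \<notin> closed_segment (p (prev_idx m j)) (p (next_idx m j))"
    using p j by (simp add: closed_billiard_trajectory_def closed_polygonal_curve_def)
  moreover have "norm (p j - p (prev_idx m j)) + norm (p (next_idx m j) - p j)
      \<le> norm (y - p (prev_idx m j)) + norm (p (next_idx m j) - y)" if "n \<bullet> (y - p j) = 0" for y
    using refl that by (simp add: reflection_hyperplane_def)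
  ultimately show ?thesis
    unfolding edge_turn_def by (rule reflection_direction[OF n(2)])
qed

text \<open>
  Every outer unit normal of the reflection hyperplane is a positive multiple of the turn, so there
  is only one, and it can be read off from the curve.
\<close>

lemma outer_unit_normal_of_reflection:
  assumes p: "closed_billiard_trajectory T m p" and T: "closed T" and j: "j < m"
    and H: "reflection_hyperplane T m p j H"
  shows "edge_turn m p j \<noteq> 0" and "edge_turn m p j \<in> outer_normal_cone T (p j)"
    and "outer_unit_normal T (p j) H \<nu> \<longleftrightarrow> \<nu> = sgn (edge_turn m p j)"
proof -
  have dir: "\<exists>c>0. edge_turn m p j = c *\<^sub>R \<nu>" if "outer_unit_normal T (p j) H \<nu>" for \<nu>
    using that H by (intro edge_turn_of_reflection[OF p T j])
      (auto simp: outer_unit_normal_def outer_normal_cone_def)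
  obtain a b where ab: "a \<noteq> 0" "H = {x. a \<bullet> x = b}" "T \<subseteq> {x. a \<bullet> x \<le> b}" "p j \<in> H"
    using H unfolding reflection_hyperplane_def supporting_hyperplane_def by blast
  have a: "outer_unit_normal T (p j) H (sgn a)"
    using ab by (auto simp: outer_unit_normal_def norm_sgn sgn_div_norm inner_diff_right
        divide_simps mult_le_0_iff)
  then obtain c where c: "c > 0" "edge_turn m p j = c *\<^sub>R sgn a"
    using dir by blast
  show "edge_turn m p j \<noteq> 0"
    using c ab(1) by (simp add: sgn_zero_iff)
  show "edge_turn m p j \<in> outer_normal_cone T (p j)"
    using c a by (simp add: outer_unit_normal_def outer_normal_cone_def mult_nonneg_nonpos)
  have "\<nu> = sgn (edge_turn m p j)" if "outer_unit_normal T (p j) H \<nu>" for \<nu>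
    using dir[OF that] that by (auto simp: outer_unit_normal_def sgn_scaleR sgn_div_norm)
  then show "outer_unit_normal T (p j) H \<nu> \<longleftrightarrow> \<nu> = sgn (edge_turn m p j)"
    using a by metis
qed

context
  fixes T :: "'a::euclidean_space set" and m :: nat and p :: "nat \<Rightarrow> 'a"
  assumes T: "billiard_table T" and p: "length_minimizing_trajectory T m p"
begin

lemma closed_table: "closed T"
  using T by (simp add: billiard_table_def compact_imp_closed)

lemma trajectory: "closed_billiard_trajectory T m p"
  using p by (simp add: length_minimizing_trajectory_def)

lemma vertex_count: "2 \<le> m"
  using trajectory by (simp add: closed_billiard_trajectory_def closed_polygonal_curve_def)

lemma edge_turn_nonzero: "j < m \<Longrightarrow> edge_turn m p j \<noteq> 0"
  and edge_turn_normal: "j < m \<Longrightarrow> edge_turn m p j \<in> outer_normal_cone T (p j)"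
  using outer_unit_normal_of_reflection(1,2)[OF trajectory closed_table] trajectory
  by (auto simp: closed_billiard_trajectory_def)

text \<open>
  The turns sum to zero, so \<open>0\<close> is in their convex hull.  If they spanned fewer than \<open>m - 1\<close>
  dimensions, Caratheodory's theorem would need fewer than \<open>m\<close> of them to balance, and the
  vertices of these alone would already not fit.
\<close>

lemma dim_span_edge_turns: "m - 1 \<le> dim (edge_turn m p ` {..<m})"
proof (rule ccontr)
  define W where "W = edge_turn m p ` {..<m}"
  assume "\<not> m - 1 \<le> dim (edge_turn m p ` {..<m})"
  then have dim: "dim W < m - 1"
    by (simp add: W_def)
  have "0 = (\<Sum>j<m. (1 / m) *\<^sub>R edge_turn m p j)"
    by (simp add: sum_edge_turn flip: scaleR_sum_right)
  also have "\<dots> \<in> convex hull W"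
    using vertex_count by (intro convex_sum) (auto simp: W_def intro: hull_inc)
  finally have 0: "0 \<in> convex hull W" .
  then have "0 \<in> affine hull W"
    using convex_hull_subset_affine_hull by blast
  then have "aff_dim W = int (dim W)"
    by (rule aff_dim_zero)
  moreover obtain S where S: "finite S" "S \<subseteq> W" "int (card S) \<le> aff_dim W + 1" "0 \<in> convex hull S"
    using 0 caratheodory_aff_dim[of W] by blast
  ultimately have card: "card S < m"
    using dim by simp
  \<comment> \<open>turns at different vertices may coincide, so one vertex is chosen for each element of \<open>S\<close>\<close>
  have "\<forall>s\<in>S. \<exists>k. k < m \<and> edge_turn m p k = s"
    using S(2) by (auto simp: W_def)
  then obtain f where f: "\<And>s. s \<in> S \<Longrightarrow> f s < m \<and> edge_turn m p (f s) = s"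
    by metis
  have "card (f ` S) < m"
    using card card_image_le[OF S(1), of f] by simp
  then have "\<not> {..<m} \<subseteq> f ` S"
    using card_mono[of "f ` S" "{..<m}"] S(1) by auto
  then obtain i where i: "i < m" "i \<notin> f ` S"
    by auto
  have "S \<subseteq> (\<Union>x\<in>p ` ({..<m} - {i}). outer_normal_cone T x - {0})"
  proof
    fix s
    assume s: "s \<in> S"
    then have "f s \<in> {..<m} - {i}" "s \<in> outer_normal_cone T (p (f s)) - {0}"
      using f[OF s] i edge_turn_normal[of "f s"] edge_turn_nonzero[of "f s"] by auto
    then show "s \<in> (\<Union>x\<in>p ` ({..<m} - {i}). outer_normal_cone T x - {0})"
      by blast
  qed
  then have "\<not> fits_inside T (p ` ({..<m} - {i}))"
    using S(4) hull_mono not_fits_inside_if_normals_balance by blast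
  then show False
    using shortest_trajectory_fits_without_vertex[OF T p i(1)] by blast
qed

text \<open>
  Write \<open>- n\<close> as a nonnegative combination of the turns in which the coefficient of some vertex \<open>i\<close>
  vanishes.  Then \<open>n\<close> and the turns at the vertices other than \<open>i\<close> balance.  If \<open>i \<noteq> j\<close>, all these are
  normals at vertices other than \<open>i\<close>, so \<open>p i\<close> could be dropped.  If \<open>i = j\<close>, then \<open>n\<close> takes
  the place of the turn at \<open>p j\<close>: moving \<open>p j\<close> orthogonally to \<open>n\<close> never makes the curve fit,
  so by minimality the curve also reflects at the hyperplane orthogonal to \<open>n\<close>, and the turn at
  \<open>p j\<close> is a multiple of \<open>n\<close>.
\<close>

lemma normal_in_span_edge_turns:
  assumes j: "j < m" and n: "n \<in> outer_normal_cone T (p j)"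
    and span: "n \<in> span (edge_turn m p ` {..<m})"
  shows "n \<in> span {edge_turn m p j}"
proof (cases "n = 0")
  case True
  then show ?thesis
    by (simp add: span_zero)
next
  case False
  have "- n \<in> span (edge_turn m p ` {..<m})"
    using span by (rule span_neg)
  from nonneg_representation_in_span[OF _ sum_edge_turn this] obtain a i where a: "\<And>k. k < m \<Longrightarrow> 0 \<le> a k" and i: "i < m" "a i = 0"
      and sum: "- n = (\<Sum>k<m. a k *\<^sub>R edge_turn m p k)"
    using vertex_count by auto
  have no_translation: False
    if nt: "n \<bullet> t < 0" and kt: "\<And>k. k < m \<Longrightarrow> k \<noteq> i \<Longrightarrow> p k + t \<in> interior T" for t
  proof -
    have "a k * (edge_turn m p k \<bullet> t) \<le> 0" if "k < m" for k
      using normal_strictly_decreases[OF edge_turn_normal edge_turn_nonzero kt, of k] a[OF that] that i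
      by (cases "k = i") (auto intro!: mult_nonneg_nonpos)
    then have "(\<Sum>k<m. a k * (edge_turn m p k \<bullet> t)) \<le> 0"
      by (intro sum_nonpos) auto
    also have "(\<Sum>k<m. a k * (edge_turn m p k \<bullet> t)) = - (n \<bullet> t)"
      using arg_cong[OF sum, of "\<lambda>v. v \<bullet> t"] by (simp add: inner_sum_left)
    finally show False
      using nt by simp
  qed
  have "i = j"
  proof (rule ccontr)
    assume "i \<noteq> j"
    obtain t where t: "\<forall>x\<in>p ` ({..<m} - {i}). x + t \<in> interior T"
      using shortest_trajectory_fits_without_vertex[OF T p i(1)] unfolding fits_inside_def by blast
    then have "p j + t \<in> interior T"
      using \<open>i \<noteq> j\<close> j by blast
    then have "n \<bullet> t < 0"
      by (rule normal_strictly_decreases[OF n False])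
    then show False
      using t by (intro no_translation[of t]) auto
  qed
  have "curve_length m p \<le> curve_length m (p(j := y))" if y: "n \<bullet> (y - p j) = 0" for y
  proof (rule shortest_trajectory_le_nonfitting_curve[OF T p], rule notI)
    assume "fits_inside T ((p(j := y)) ` {..<m})"
    then obtain t where t: "\<forall>k<m. (p(j := y)) k + t \<in> interior T"
      unfolding fits_inside_def by blast
    have "p j + (y - p j + t) \<in> interior T"
      using t j by auto
    then have "n \<bullet> (y - p j + t) < 0"
      by (rule normal_strictly_decreases[OF n False])
    then have "n \<bullet> t < 0"
      using y by (simp add: inner_add_right)
    then show False
      using t \<open>i = j\<close> by (intro no_translation[of t]) auto
  qed
  then have "reflection_hyperplane T m p j {y. n \<bullet> (y - p j) = 0}"
    by (rule reflection_at_normal_of_shortest_curve[where p = p, OF vertex_count j n False])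
  then obtain c where "c > 0" "edge_turn m p j = c *\<^sub>R n"
    using edge_turn_of_reflection[OF trajectory closed_table j n False] by blast
  then have "n = (1 / c) *\<^sub>R edge_turn m p j"
    by simp
  then show ?thesis
    by (metis span_base span_scale singletonI)
qed

end

lemma edge_turn_in_direction_space:
  assumes "subspace V\<^sub>0" "affine_parallel V\<^sub>0 (affine hull (p ` {..<m}))" "j < m"
  shows "edge_turn m p j \<in> V\<^sub>0"
proof -
  obtain a where a: "affine hull (p ` {..<m}) = (\<lambda>x. a + x) ` V\<^sub>0"
    using assms(2) unfolding affine_parallel_def by blast
  have "p k - p l \<in> V\<^sub>0" if kl: "k < m" "l < m" for k l
  proof -
    have "p k \<in> (\<lambda>x. a + x) ` V\<^sub>0" "p l \<in> (\<lambda>x. a + x) ` V\<^sub>0"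
      unfolding a[symmetric] using kl by (auto intro: hull_inc)
    then obtain v w where "v \<in> V\<^sub>0" "w \<in> V\<^sub>0" "p k = a + v" "p l = a + w"
      by blast
    then show ?thesis
      using subspace_diff[OF assms(1), of v w] by simp
  qed
  then have "p j - p (prev_idx m j) \<in> V\<^sub>0" "p (next_idx m j) - p j \<in> V\<^sub>0"
    using assms(3) next_idx_less[OF assms(3)] prev_idx_less[OF assms(3)] by blast+
  then show ?thesis
    unfolding edge_turn_def sgn_div_norm by (simp add: subspace_diff[OF assms(1)] subspace_scale[OF assms(1)])
qed

theorem theorem1p2:
  fixes T :: "(real ^ 'n) set" and m :: nat and p :: "nat \<Rightarrow> real ^ 'n"
    and H :: "nat \<Rightarrow> (real ^ 'n) set" and U V V\<^sub>0 :: "(real ^ 'n) set"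
  assumes "billiard_table T"
    and "length_minimizing_trajectory T m p"
    and "\<forall>j<m. reflection_hyperplane T m p j (H j)"
    and "U = convex_cone hull {\<nu>. \<exists>j<m. outer_unit_normal T (p j) (H j) \<nu>}"
    and "minimal_section_space T (p ` {..<m}) V"
    and "subspace V\<^sub>0" and "affine_parallel V\<^sub>0 V" and "int (dim V\<^sub>0) = aff_dim V"
  shows "U = V\<^sub>0 \<and> int (dim U) = aff_dim V \<and> aff_dim V = int m - 1 \<and>
    (\<forall>j<m. dim (outer_normal_cone T (p j) \<inter> V\<^sub>0) = 1)"
proof -
  note T = assms(1) and p = assms(2)
  define w where "w = edge_turn m p"
  define W where "W = span (w ` {..<m})"
  have m: "2 \<le> m"
    by (rule vertex_count[OF T p])
  have V: "V = affine hull (p ` {..<m})"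
    using assms(5) by (simp add: minimal_section_space_def)
  have w_V\<^sub>0: "w ` {..<m} \<subseteq> V\<^sub>0"
    using edge_turn_in_direction_space[OF assms(6)] assms(7) by (auto simp: w_def V)
  then have "W \<subseteq> V\<^sub>0"
    unfolding W_def by (rule span_minimal[OF _ assms(6)])
  moreover have dim_V\<^sub>0: "dim V\<^sub>0 \<le> m - 1"
  proof -
    have "aff_dim V \<le> int (card (p ` {..<m})) - 1"
      unfolding V aff_dim_affine_hull by (rule aff_dim_le_card) simp
    then show ?thesis
      using assms(8) card_image_le[of "{..<m}" p] m by simp
  qed
  moreover have dim_W: "m - 1 \<le> dim W"
    using dim_span_edge_turns[OF T p] by (simp add: W_def w_def)
  ultimately have W_V\<^sub>0: "W = V\<^sub>0"
    using assms(6) by (intro subspace_dim_equal) (auto simp: W_def)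
  have "{\<nu>. \<exists>j<m. outer_unit_normal T (p j) (H j) \<nu>} = (\<lambda>j. sgn (w j)) ` {..<m}"
    using outer_unit_normal_of_reflection(3)[OF trajectory[OF T p] closed_table[OF T p]] assms(3)
    by (auto simp: w_def)
  then have U: "U = convex_cone hull ((\<lambda>j. sgn (w j)) ` {..<m})"
    using assms(4) by simp
  have "U \<subseteq> W"
    unfolding U
  proof (rule hull_minimal)
    show "(\<lambda>j. sgn (w j)) ` {..<m} \<subseteq> W"
      unfolding W_def sgn_div_norm by (auto intro: span_scale span_base)
    show "convex_cone W"
      unfolding W_def by (rule convex_cone_span)
  qed
  moreover have "W \<subseteq> U"
  proof
    fix x
    assume "x \<in> W"
    then obtain a where a: "\<And>k. k < m \<Longrightarrow> 0 \<le> a k" "x = (\<Sum>k<m. a k *\<^sub>R w k)"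
      using nonneg_representation_in_span[of m w x] sum_edge_turn[of m p] m by (auto simp: W_def w_def)
    have "a k *\<^sub>R w k \<in> U" if k: "k < m" for k
    proof -
      have "(a k * norm (w k)) *\<^sub>R sgn (w k) \<in> U"
        unfolding U using a(1)[OF k] k by (intro convex_cone_hull_mul hull_inc) auto
      then show ?thesis
        by (cases "w k = 0") (simp_all add: sgn_div_norm mult.assoc)
    qed
    moreover have "(\<Sum>k\<in>K. a k *\<^sub>R w k) \<in> U" if "finite K" "\<And>k. k \<in> K \<Longrightarrow> a k *\<^sub>R w k \<in> U" for K
      using that by (induction K rule: finite_induct)
        (auto simp: U intro: convex_cone_hull_contains_0 convex_cone_hull_add)
    ultimately show "x \<in> U"
      unfolding a(2) by auto
  qed
  ultimately have "U = V\<^sub>0"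
    using W_V\<^sub>0 by blast
  moreover have "dim V\<^sub>0 = m - 1"
    using dim_V\<^sub>0 dim_W W_V\<^sub>0 by simp
  moreover have "dim (outer_normal_cone T (p j) \<inter> V\<^sub>0) = 1" if j: "j < m" for j
  proof -
    have "outer_normal_cone T (p j) \<inter> V\<^sub>0 \<subseteq> span {w j}"
      using normal_in_span_edge_turns[OF T p j] W_V\<^sub>0 by (auto simp: W_def w_def)
    moreover have "w j \<in> outer_normal_cone T (p j) \<inter> V\<^sub>0"
      using edge_turn_normal[OF T p j] w_V\<^sub>0 j by (auto simp: w_def)
    ultimately have "dim (outer_normal_cone T (p j) \<inter> V\<^sub>0) = dim {w j}"
      by (intro antisym) (metis dim_span dim_subset, rule dim_subset, simp)
    then show ?thesis
      using edge_turn_nonzero[OF T p j] by (simp add: w_def)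
  qed
  ultimately show ?thesis
    using assms(8) m by (auto simp: of_nat_diff)
qed

end
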